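(* Let $X$ be a compact metric space with a countable basis $\mathbb{P}$ of non-empty open sets, and let $(p_n)$ be any enumeration of $\mathbb{P}$. Then $\mathbb{P}$ is an $\omega$-cap-basis of $X$ if and only if $\mathrm{diam}(p_n)\to 0$.
   Context: An enumeration of $\mathbb{P}$ lists each element of $\mathbb{P}$ exactly once (if $\mathbb{P}$ is finite the convergence condition is vacuous); thus the condition $\mathrm{diam}(p_n)\to0$ means that for each $\varepsilon>0$ only finitely many $p\in\mathbb{P}$ have $\mathrm{diam}(p)\geq\varepsilon$. Let $(\mathbb{P},\leq)$ be a poset. A subset $S\subseteq\mathbb{P}$ refines $T\subseteq\mathbb{P}$ if for every $s\in S$ there is $t\in T$ with $s\leq t$. A band of $\mathbb{P}$ is a finite subset $B\subseteq\mathbb{P}$ such that every $p\in\mathbb{P}$ is comparable to some $b\in B$. A cap of $\mathbb{P}$ is a subset refined by some band. $\mathbb{P}$ is an $\omega$-poset if every principal filter $p^\leq=\{q\in\mathbb{P}:p\leq q\}$ is finite and, for each $n\in\omega$, the number of principal filters of size $n$ is finite. A basis $\mathbb{P}$ of a topological space $X$, ordered by inclusion, is a cap-basis if for all $C\subseteq\mathbb{P}$, $C$ is a cap of $\mathbb{P}$ if and only if $X=\bigcup C$. It is an $\omega$-cap-basis if it is a cap-basis and also an $\omega$-poset with respect to inclusion. *)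

theory Defs
  imports "HOL-Analysis.Analysis"
begin

text \<open>
  A poset is a carrier \<open>P\<close> inside a type of class \<open>order\<close>, with the order of that type restricted
  to \<open>P\<close>. For families of sets (type \<open>'a set set\<close>) this order is inclusion.
\<close>

definition refines :: "'p::order set \<Rightarrow> 'p set \<Rightarrow> bool" where
  "refines S T \<longleftrightarrow> (\<forall>s\<in>S. \<exists>t\<in>T. s \<le> t)"

definition band :: "'p::order set \<Rightarrow> 'p set \<Rightarrow> bool" where
  "band P B \<longleftrightarrow> B \<subseteq> P \<and> finite B \<and> (\<forall>p\<in>P. \<exists>b\<in>B. p \<le> b \<or> b \<le> p)"

definition cap :: "'p::order set \<Rightarrow> 'p set \<Rightarrow> bool" where
  "cap P C \<longleftrightarrow> C \<subseteq> P \<and> (\<exists>B. band P B \<and> refines B C)"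

definition principal_filter :: "'p::order set \<Rightarrow> 'p \<Rightarrow> 'p set" where
  "principal_filter P p = {q \<in> P. p \<le> q}"

definition omega_poset :: "'p::order set \<Rightarrow> bool" where
  "omega_poset P \<longleftrightarrow>
     (\<forall>p\<in>P. finite (principal_filter P p)) \<and>
     (\<forall>n. finite {F \<in> principal_filter P ` P. card F = n})"

definition basis_of :: "'a topology \<Rightarrow> 'a set set \<Rightarrow> bool" where
  "basis_of X P \<longleftrightarrow>
     (\<forall>U\<in>P. openin X U) \<and> (\<forall>U. openin X U \<longrightarrow> (\<exists>Q\<subseteq>P. U = \<Union>Q))"

definition cap_basis :: "'a topology \<Rightarrow> 'a set set \<Rightarrow> bool" where
  "cap_basis X P \<longleftrightarrow> basis_of X P \<and> (\<forall>C\<subseteq>P. cap P C \<longleftrightarrow> topspace X = \<Union>C)"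

definition omega_cap_basis :: "'a topology \<Rightarrow> 'a set set \<Rightarrow> bool" where
  "omega_cap_basis X P \<longleftrightarrow> cap_basis X P \<and> omega_poset P"

text \<open>
  An enumeration lists each element of \<open>P\<close> exactly once. It is indexed by all of \<open>nat\<close> or, if \<open>P\<close>
  is finite, by a proper initial segment; the values of \<open>p\<close> outside the index set \<open>N\<close> are irrelevant.
\<close>

definition enumeration_of :: "nat set \<Rightarrow> (nat \<Rightarrow> 'p) \<Rightarrow> 'p set \<Rightarrow> bool" where
  "enumeration_of N p P \<longleftrightarrow> (N = UNIV \<or> (\<exists>k. N = {..<k})) \<and> bij_betw p N P"

end

theory Submission
  imports Defs
begin

text \<open>
  Call the diameters of \<open>P\<close> vanishing if only finitely many members of \<open>P\<close> have diameter at
  least \<open>e\<close>, for every \<open>e > 0\<close>; along an enumeration this is convergence to \<open>0\<close>.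

  If \<open>P\<close> is an \<open>\<omega>\<close>-cap-basis, the members of diameter less than \<open>e\<close> cover \<open>X\<close>, hence are refined
  by a band \<open>B\<close>. A member of diameter at least \<open>e\<close> lies below no element of \<open>B\<close>, so it lies above
  one; as \<open>B\<close> and all principal filters are finite, there are finitely many such members
  (\<open>vanishing_if_omega_cap_basis\<close>).

  Conversely, let the diameters vanish. Lebesgue numbers then say that for every open cover all but
  finitely many members of \<open>P\<close> lie inside some set of the cover
  (\<open>cover_contains_almost_all\<close>). Two covers are used.
  First, a finite subcover of a given cover \<open>C \<subseteq> P\<close> becomes a band refining \<open>C\<close> after adjoining, for
  each of the finitely many members contained in no set of the subcover, a smaller member of \<open>P\<close>
  that lies in an element of \<open>C\<close> (\<open>cap_if_cover\<close>). Secondly, each point has a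
  neighbourhood containing only finitely many members of \<open>P\<close> whose principal filter has at most
  \<open>n\<close> elements: a non-isolated point belongs to infinitely many members, and what lies in the
  intersection of \<open>n + 1\<close> of them has a larger filter. Together these neighbourhoods bound the
  number of filters of size \<open>n\<close> (\<open>omega_poset_if_vanishing\<close>).
  That caps are covers is true for any basis of non-empty sets in a \<open>T\<^sub>1\<close> space, because a point outside
  a finite union of such sets has a neighbourhood containing none of them
  (\<open>cover_if_cap\<close>).
\<close>

section \<open>Bases and diameters\<close>

definition vanishing_diameters :: "'a::metric_space set set \<Rightarrow> bool" where
  "vanishing_diameters P \<longleftrightarrow> (\<forall>e>0. finite {q\<in>P. diameter q \<ge> e})"

lemma basis_ofD_openin: "basis_of T P \<Longrightarrow> U \<in> P \<Longrightarrow> openin T U"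
  by (simp add: basis_of_def)

lemma basis_of_obtain:
  assumes "basis_of T P" "openin T U" "x \<in> U"
  obtains q where "q \<in> P" "x \<in> q" "q \<subseteq> U"
proof -
  from assms obtain Q where "Q \<subseteq> P" "U = \<Union>Q"
    unfolding basis_of_def by blast
  with \<open>x \<in> U\<close> that show ?thesis by blast
qed

lemma diameter_mono_compact:
  fixes X :: "'a::metric_space set"
  assumes "compact X" "S \<subseteq> T" "T \<subseteq> X"
  shows "diameter S \<le> diameter T"
  by (meson assms bounded_subset compact_imp_bounded diameter_subset)

lemma diameter_le_if_subset_ball:
  fixes S :: "'a::metric_space set"
  assumes "S \<subseteq> ball x e" "e > 0"
  shows "diameter S \<le> 2 * e"
proof (cases "S = {}")
  case False
  have "dist y z \<le> 2 * e" if "y \<in> S" "z \<in> S" for y z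
  proof -
    have "dist x y < e" "dist x z < e" using assms(1) that by auto
    then show ?thesis using dist_triangle3[of y z x] by linarith
  qed
  then show ?thesis
    using False by (auto simp: diameter_def intro!: cSUP_least)
qed (use assms in simp)

section \<open>Caps are covers\<close>

text \<open>
  A point outside \<open>\<Union>B\<close> differs from a chosen point of each \<open>b \<in> B\<close>. Removing these finitely many
  points leaves an open set, and a basic neighbourhood of the given point inside it is comparable
  to no \<open>b\<close>.
\<close>
lemma band_covers:
  fixes X :: "'a::t1_space set"
  assumes basis: "basis_of (top_of_set X) P" and ne: "{} \<notin> P" and band: "band P B"
  shows "X \<subseteq> \<Union>B"
proof (rule ccontr)
  assume "\<not> X \<subseteq> \<Union>B"
  then obtain x where x: "x \<in> X" "x \<notin> \<Union>B" by blast
  from band have B: "B \<subseteq> P" "finite B" "\<And>q. q \<in> P \<Longrightarrow> \<exists>b\<in>B. q \<subseteq> b \<or> b \<subseteq> q"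
    by (auto simp: band_def)
  have "\<forall>b\<in>B. \<exists>y. y \<in> b" using B(1) ne by (metis all_not_in_conv subsetD)
  then obtain y where y: "\<And>b. b \<in> B \<Longrightarrow> y b \<in> b" by metis
  have "openin (top_of_set X) (X - y ` B)"
    using B(2) by (metis Diff_eq finite_imageI finite_imp_closed open_Compl openin_open_Int)
  moreover have "x \<in> X - y ` B" using x y by blast
  ultimately obtain q where q: "q \<in> P" "x \<in> q" "q \<subseteq> X - y ` B"
    using basis_of_obtain[OF basis] by metis
  from B(3)[OF q(1)] obtain b where "b \<in> B" "q \<subseteq> b \<or> b \<subseteq> q" by blast
  then show False using q x y by blast
qed

lemma cover_if_cap:
  fixes X :: "'a::t1_space set"
  assumes basis: "basis_of (top_of_set X) P" and ne: "{} \<notin> P" and "cap P C"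
  shows "\<Union>C = X"
proof -
  from \<open>cap P C\<close> obtain B where B: "C \<subseteq> P" "band P B" "refines B C"
    by (auto simp: cap_def)
  have "\<Union>B \<subseteq> \<Union>C" using B(3) by (fastforce simp: refines_def)
  moreover have "\<Union>C \<subseteq> X"
    using B(1) basis_ofD_openin[OF basis] openin_imp_subset by blast
  ultimately show ?thesis using band_covers[OF basis ne B(2)] by blast
qed

section \<open>Covers are caps\<close>

text \<open>
  A set of diameter below a Lebesgue number of the cover lies inside some \<open>V \<in> D\<close>, and only
  finitely many members of \<open>P\<close> are larger than that.
\<close>
lemma cover_contains_almost_all:
  fixes X :: "'a::metric_space set"
  assumes comp: "compact X" and PX: "\<And>q. q \<in> P \<Longrightarrow> q \<subseteq> X"
    and ne: "{} \<notin> P" and van: "vanishing_diameters P"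
    and op: "\<And>V. V \<in> D \<Longrightarrow> openin (top_of_set X) V" and cover: "X \<subseteq> \<Union>D"
  shows "finite {q\<in>P. \<not> (\<exists>V\<in>D. q \<subseteq> V)}"
proof (cases "X = {}")
  case True
  then have "P = {}" using PX ne by (metis all_not_in_conv subset_empty)
  then show ?thesis by simp
next
  case False
  \<comment> \<open>\<open>D\<close> is open only relative to \<open>X\<close>; \<open>D'\<close> collects the open extensions of its members\<close>
  define D' where "D' = {U. open U \<and> X \<inter> U \<in> D}"
  have cov: "X \<subseteq> \<Union>D'"
  proof
    fix x assume "x \<in> X"
    then obtain V where V: "V \<in> D" "x \<in> V" using cover by blast
    then obtain U where "open U" "V = X \<inter> U" using op by (metis openin_open)
    then show "x \<in> \<Union>D'" using V by (auto simp: D'_def)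
  qed
  have ne': "D' \<noteq> {}" using False cov by blast
  obtain d where d: "d > 0" "\<And>T. T \<subseteq> X \<Longrightarrow> diameter T < d \<Longrightarrow> \<exists>U\<in>D'. T \<subseteq> U"
    by (rule Lebesgue_number_lemma[OF comp ne' cov]) (simp add: D'_def, rule that)
  have "{q\<in>P. \<not> (\<exists>V\<in>D. q \<subseteq> V)} \<subseteq> {q\<in>P. diameter q \<ge> d}"
  proof clarify
    fix q assume q: "q \<in> P" "\<not> (\<exists>V\<in>D. q \<subseteq> V)"
    show "d \<le> diameter q"
    proof (rule ccontr)
      assume "\<not> d \<le> diameter q"
      then obtain U where U: "U \<in> D'" "q \<subseteq> U" using d(2)[OF PX[OF q(1)]] by auto
      then have "X \<inter> U \<in> D" "q \<subseteq> X \<inter> U" using PX[OF q(1)] by (auto simp: D'_def)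
      then show False using q(2) by blast
    qed
  qed
  then show ?thesis
    using van d(1) by (auto simp: vanishing_diameters_def intro: finite_subset)
qed

text \<open>
  A finite subcover \<open>F\<close> need not be a band: a large member of \<open>P\<close> may overlap every set of \<open>F\<close>
  without being comparable to any. The finitely many members of \<open>P\<close> for which this can happen
  are given an element \<open>b q\<close> of the band below them.
\<close>
lemma cap_if_cover:
  fixes X :: "'a::metric_space set"
  assumes comp: "compact X" and basis: "basis_of (top_of_set X) P" and ne: "{} \<notin> P"
    and van: "vanishing_diameters P" and C: "C \<subseteq> P" and cover: "X \<subseteq> \<Union>C"
  shows "cap P C"
proof -
  have op: "openin (top_of_set X) q" if "q \<in> P" for q
    using basis_ofD_openin[OF basis that] .
  have PX: "q \<subseteq> X" if "q \<in> P" for q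
    using op[OF that] openin_imp_subset by blast
  obtain F where F: "F \<subseteq> C" "finite F" "X \<subseteq> \<Union>F"
    using comp C cover op unfolding compact_eq_openin_cover by (metis subsetD)
  define L where "L = {q\<in>P. \<not> (\<exists>V\<in>F. q \<subseteq> V)}"
  have finL: "finite L"
    unfolding L_def using C F op by (intro cover_contains_almost_all[OF comp PX ne van]) auto
  have "\<exists>b\<in>P. b \<subseteq> q \<and> (\<exists>c\<in>C. b \<subseteq> c)" if q: "q \<in> P" for q
  proof -
    obtain x where x: "x \<in> q" using q ne by (metis all_not_in_conv)
    then obtain c where c: "c \<in> C" "x \<in> c" using PX[OF q] cover by blast
    have "openin (top_of_set X) (q \<inter> c)" using op q c C by blast
    then obtain b where "b \<in> P" "x \<in> b" "b \<subseteq> q \<inter> c"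
      using basis_of_obtain[OF basis] x c by (metis IntI)
    then show ?thesis using c by blast
  qed
  then obtain b where b: "\<And>q. q \<in> P \<Longrightarrow> b q \<in> P \<and> b q \<subseteq> q \<and> (\<exists>c\<in>C. b q \<subseteq> c)"
    by metis
  define B where "B = F \<union> b ` L"
  have "band P B"
    unfolding band_def
  proof (intro conjI ballI)
    show "B \<subseteq> P" using F(1) C b by (auto simp: B_def L_def)
    show "finite B" using F(2) finL by (simp add: B_def)
    show "\<exists>a\<in>B. q \<le> a \<or> a \<le> q" if "q \<in> P" for q
      using b[OF that] that by (cases "q \<in> L") (auto simp: B_def L_def)
  qed
  moreover have "refines B C"
    unfolding refines_def
  proof
    fix s assume "s \<in> B"
    then show "\<exists>t\<in>C. s \<le> t" using F(1) b by (auto simp: B_def L_def)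
  qed
  ultimately show ?thesis using C by (auto simp: cap_def)
qed

section \<open>Principal filters under vanishing diameters\<close>

text \<open>
  A positive diameter bounds the diameters of all larger sets from below. Isolated
  points need a separate bound, since the diameter of a singleton is \<open>0\<close>: a set that contains an
  isolated point and something else has diameter at least the radius of isolation.
\<close>
lemma finite_principal_filter_if_vanishing:
  fixes X :: "'a::metric_space set"
  assumes comp: "compact X" and basis: "basis_of (top_of_set X) P" and ne: "{} \<notin> P"
    and van: "vanishing_diameters P" and q: "q \<in> P"
  shows "finite (principal_filter P q)"
proof -
  have sub: "r \<subseteq> X" "bounded r" if "r \<in> P" for r
    using basis_ofD_openin[OF basis that] openin_imp_subset comp
    by (blast, meson bounded_subset compact_imp_bounded openin_imp_subset)
  obtain x where x: "x \<in> q" using q ne by (metis all_not_in_conv)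
  obtain e where e: "e > 0" "X \<inter> ball x e \<subseteq> q"
    using basis_ofD_openin[OF basis q] x
    by (metis Int_commute openin_contains_ball)
  \<comment> \<open>one bound for both cases: a larger set either reaches outside the ball, or contains a
    second point of \<open>q\<close>, or equals \<open>q\<close>\<close>
  have "\<exists>d>0. \<forall>r\<in>P. q \<subseteq> r \<longrightarrow> r = q \<or> d \<le> diameter r"
  proof (cases "q = {x}")
    case True
    have "e \<le> diameter r" if r: "r \<in> P" "q \<subseteq> r" "r \<noteq> q" for r
    proof -
      obtain z where z: "z \<in> r" "z \<noteq> x" using r x True by blast
      then have "z \<notin> ball x e" using e sub[OF r(1)] True by blast
      then have "e \<le> dist x z" by simp
      also have "\<dots> \<le> diameter r"
        using diameter_bounded_bound[OF sub(2)[OF r(1)]] x r(2) z by blast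
      finally show ?thesis .
    qed
    then show ?thesis using e(1) by blast
  next
    case False
    then obtain z where z: "z \<in> q" "z \<noteq> x" using x by blast
    have "dist x z \<le> diameter r" if "r \<in> P" "q \<subseteq> r" for r
      using diameter_bounded_bound[OF sub(2)[OF that(1)]] x z that(2) by blast
    then show ?thesis using z by (metis zero_less_dist_iff)
  qed
  then obtain d where "d > 0" and d: "\<And>r. r \<in> P \<Longrightarrow> q \<subseteq> r \<Longrightarrow> r = q \<or> d \<le> diameter r"
    by blast
  have "principal_filter P q \<subseteq> insert q {r\<in>P. d \<le> diameter r}"
    using d by (auto simp: principal_filter_def)
  then show ?thesis
    using van \<open>d > 0\<close> by (auto simp: vanishing_diameters_def intro: finite_subset)
qed

text \<open>
  If only finitely many members of \<open>P\<close> contained \<open>x\<close>, their intersection would be open and, in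
  a \<open>T\<^sub>1\<close> space, could contain no point besides \<open>x\<close>.
\<close>
lemma infinite_basis_at_nonisolated:
  fixes X :: "'a::t1_space set"
  assumes basis: "basis_of (top_of_set X) P" and x: "x \<in> X"
    and nonisol: "\<not> openin (top_of_set X) {x}"
  shows "infinite {q\<in>P. x \<in> q}"
proof
  assume fin: "finite {q\<in>P. x \<in> q}"
  define W where "W = X \<inter> \<Inter>{q\<in>P. x \<in> q}"
  have top: "openin (top_of_set X) X" by simp
  have "{q\<in>P. x \<in> q} \<noteq> {}" using basis_of_obtain[OF basis top x] by blast
  then have "openin (top_of_set X) W"
    unfolding W_def using fin basis_ofD_openin[OF basis] by (intro openin_Int openin_Inter) auto
  moreover have "x \<in> W" using x by (auto simp: W_def)
  ultimately obtain y where y: "y \<in> W" "y \<noteq> x" using nonisol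
    by (metis insertI1 insert_absorb is_singletonI' is_singleton_the_elem singletonD)
  have "openin (top_of_set X) (X - {y})"
    by (metis Diff_eq closed_singleton open_Compl openin_open_Int)
  then obtain q where "q \<in> P" "x \<in> q" "q \<subseteq> X - {y}"
    using basis_of_obtain[OF basis] x y by (metis DiffI singletonD)
  then show False using y by (auto simp: W_def)
qed

text \<open>
  At an isolated point \<open>V\<close> is the singleton, which has only two subsets. Otherwise \<open>V\<close> is the
  intersection of \<open>n + 1\<close> members of \<open>P\<close>, all of which belong to the filter of any \<open>q \<subseteq> V\<close>.
\<close>
lemma locally_finite_small_filters:
  fixes X :: "'a::t1_space set"
  assumes basis: "basis_of (top_of_set X) P"
    and fin: "\<And>q. q \<in> P \<Longrightarrow> finite (principal_filter P q)"
    and x: "x \<in> X"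
  shows "\<exists>V. openin (top_of_set X) V \<and> x \<in> V \<and>
           finite {q\<in>P. q \<subseteq> V \<and> card (principal_filter P q) \<le> n}"
proof (cases "openin (top_of_set X) {x}")
  case True
  have "{q\<in>P. q \<subseteq> {x} \<and> card (principal_filter P q) \<le> n} \<subseteq> Pow {x}" by blast
  then have "finite {q\<in>P. q \<subseteq> {x} \<and> card (principal_filter P q) \<le> n}"
    by (rule finite_subset) simp
  with True show ?thesis by blast
next
  case False
  obtain S where S: "finite S" "card S = Suc n" "S \<subseteq> {q\<in>P. x \<in> q}"
    using infinite_arbitrarily_large[OF infinite_basis_at_nonisolated[OF basis x False]] by blast
  have "openin (top_of_set X) (\<Inter>S)"
    using S basis_ofD_openin[OF basis] by (intro openin_Inter) auto
  moreover have "{q\<in>P. q \<subseteq> \<Inter>S \<and> card (principal_filter P q) \<le> n} = {}"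
  proof -
    have "card S \<le> card (principal_filter P q)" if "q \<in> P" "q \<subseteq> \<Inter>S" for q
      using that S by (intro card_mono fin) (auto simp: principal_filter_def)
    then show ?thesis using S(2) by fastforce
  qed
  moreover have "x \<in> \<Inter>S" using S(3) by blast
  ultimately show ?thesis by (metis finite.emptyI)
qed

lemma omega_poset_if_vanishing:
  fixes X :: "'a::metric_space set"
  assumes comp: "compact X" and basis: "basis_of (top_of_set X) P" and ne: "{} \<notin> P"
    and van: "vanishing_diameters P"
  shows "omega_poset P"
  unfolding omega_poset_def
proof (intro conjI ballI allI)
  show fin: "finite (principal_filter P q)" if "q \<in> P" for q
    using finite_principal_filter_if_vanishing[OF comp basis ne van that] .
  fix n
  let ?small = "\<lambda>V. {q\<in>P. q \<subseteq> V \<and> card (principal_filter P q) \<le> n}"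
  define D where "D = {V. openin (top_of_set X) V \<and> finite (?small V)}"
  have "X \<subseteq> \<Union>D"
    using locally_finite_small_filters[OF basis fin] unfolding D_def by blast
  then obtain E where E: "E \<subseteq> D" "finite E" "X \<subseteq> \<Union>E"
    using comp unfolding compact_eq_openin_cover D_def by (metis (no_types, lifting) mem_Collect_eq)
  have PX: "q \<subseteq> X" if "q \<in> P" for q
    using basis_ofD_openin[OF basis that] openin_imp_subset by blast
  have "finite {q\<in>P. \<not> (\<exists>V\<in>E. q \<subseteq> V)}"
    using E by (intro cover_contains_almost_all[OF comp PX ne van]) (auto simp: D_def)
  moreover have "finite (\<Union>V\<in>E. ?small V)" using E by (auto simp: D_def)
  moreover have "{q\<in>P. card (principal_filter P q) \<le> n}
      \<subseteq> {q\<in>P. \<not> (\<exists>V\<in>E. q \<subseteq> V)} \<union> (\<Union>V\<in>E. ?small V)" by blast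
  ultimately have "finite {q\<in>P. card (principal_filter P q) \<le> n}"
    by (meson finite_Un finite_subset)
  then have "finite (principal_filter P ` {q\<in>P. card (principal_filter P q) \<le> n})" by simp
  then show "finite {F \<in> principal_filter P ` P. card F = n}"
    by (rule rev_finite_subset) auto
qed

section \<open>The characterisation\<close>

text \<open>
  A member of diameter at least \<open>e\<close> cannot lie below the band that refines the cover by
  smaller members, so it belongs to the principal filter of an element of the band.
\<close>
lemma vanishing_if_omega_cap_basis:
  fixes X :: "'a::metric_space set"
  assumes comp: "compact X" and ocb: "omega_cap_basis (top_of_set X) P"
  shows "vanishing_diameters P"
  unfolding vanishing_diameters_def
proof (intro allI impI)
  fix e :: real assume e: "e > 0"
  have basis: "basis_of (top_of_set X) P"
    and capI: "\<And>C. C \<subseteq> P \<Longrightarrow> X = \<Union>C \<Longrightarrow> cap P C"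
    and fin: "\<And>q. q \<in> P \<Longrightarrow> finite (principal_filter P q)"
    using ocb by (auto simp: omega_cap_basis_def cap_basis_def omega_poset_def)
  have PX: "q \<subseteq> X" if "q \<in> P" for q
    using basis_ofD_openin[OF basis that] openin_imp_subset by blast
  define C where "C = {q\<in>P. diameter q < e}"
  have "X \<subseteq> \<Union>C"
  proof
    fix x assume x: "x \<in> X"
    have "openin (top_of_set X) (X \<inter> ball x (e/3))" by (simp add: openin_open_Int)
    then obtain q where q: "q \<in> P" "x \<in> q" "q \<subseteq> X \<inter> ball x (e/3)"
      using basis_of_obtain[OF basis] x e by (metis IntI centre_in_ball divide_pos_pos zero_less_numeral)
    have "diameter q \<le> 2 * (e/3)"
      using q e by (intro diameter_le_if_subset_ball) auto
    then show "x \<in> \<Union>C" using q e by (auto simp: C_def)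
  qed
  moreover have "\<Union>C \<subseteq> X" using PX by (auto simp: C_def)
  ultimately have "cap P C" by (intro capI) (auto simp: C_def)
  then obtain B where B: "B \<subseteq> P" "finite B" "\<And>q. q \<in> P \<Longrightarrow> \<exists>b\<in>B. q \<subseteq> b \<or> b \<subseteq> q"
    and ref: "\<And>b. b \<in> B \<Longrightarrow> \<exists>c\<in>C. b \<subseteq> c"
    by (auto simp: cap_def band_def refines_def)
  have "{q\<in>P. e \<le> diameter q} \<subseteq> (\<Union>b\<in>B. principal_filter P b)"
  proof clarify
    fix q assume q: "q \<in> P" "e \<le> diameter q"
    obtain b where b: "b \<in> B" "q \<subseteq> b \<or> b \<subseteq> q" using B(3)[OF q(1)] by blast
    obtain c where c: "c \<in> C" "b \<subseteq> c" using ref[OF b(1)] by blast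
    have "\<not> q \<subseteq> b"
    proof
      assume "q \<subseteq> b"
      then have "diameter q \<le> diameter c"
        using c PX by (intro diameter_mono_compact[OF comp]) (auto simp: C_def)
      then show False using c(1) q(2) by (simp add: C_def)
    qed
    then show "q \<in> (\<Union>b\<in>B. principal_filter P b)"
      using b q(1) by (auto simp: principal_filter_def)
  qed
  moreover have "finite (\<Union>b\<in>B. principal_filter P b)" using B fin by blast
  ultimately show "finite {q\<in>P. e \<le> diameter q}" by (rule finite_subset)
qed

lemma omega_cap_basis_iff_vanishing:
  fixes X :: "'a::metric_space set"
  assumes comp: "compact X" and basis: "basis_of (top_of_set X) P" and ne: "{} \<notin> P"
  shows "omega_cap_basis (top_of_set X) P \<longleftrightarrow> vanishing_diameters P"
proof
  assume van: "vanishing_diameters P"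
  have "cap P C \<longleftrightarrow> X = \<Union>C" if "C \<subseteq> P" for C
    using cover_if_cap[OF basis ne] cap_if_cover[OF comp basis ne van that] by blast
  then show "omega_cap_basis (top_of_set X) P"
    using basis omega_poset_if_vanishing[OF comp basis ne van]
    by (simp add: omega_cap_basis_def cap_basis_def)
qed (rule vanishing_if_omega_cap_basis[OF comp])

lemma vanishing_iff_enumeration_tendsto:
  fixes P :: "'a::metric_space set set"
  assumes bounded: "\<And>q. q \<in> P \<Longrightarrow> bounded q" and enum: "enumeration_of N p P"
  shows "vanishing_diameters P \<longleftrightarrow> (infinite P \<longrightarrow> (\<lambda>n. diameter (p n)) \<longlonglongrightarrow> 0)"
proof (cases "finite P")
  case True
  then show ?thesis by (simp add: vanishing_diameters_def)
next
  case False
  from enum have bij: "bij_betw p N P" by (simp add: enumeration_of_def)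
  then have "infinite N" using False bij_betw_finite by blast
  then have "N = UNIV" using enum by (auto simp: enumeration_of_def)
  then have inj: "inj p" and P: "P = range p"
    using bij by (auto simp: bij_betw_def)
  have nonneg: "0 \<le> diameter (p n)" for n
    using bounded P by (auto intro: diameter_ge_0)
  have "finite {q\<in>P. e \<le> diameter q} \<longleftrightarrow> (\<forall>\<^sub>F n in sequentially. diameter (p n) < e)" for e
  proof -
    have "{q\<in>P. e \<le> diameter q} = p ` {n. \<not> diameter (p n) < e}"
      using P by auto
    then have "finite {q\<in>P. e \<le> diameter q} \<longleftrightarrow> finite {n. \<not> diameter (p n) < e}"
      using inj by (metis finite_image_iff inj_on_subset subset_UNIV)
    then show ?thesis by (simp add: eventually_cofinite flip: cofinite_eq_sequentially)
  qed
  then show ?thesis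
    using False nonneg by (simp add: vanishing_diameters_def tendsto_iff)
qed

theorem proposition1p17:
  fixes X :: "'a::metric_space set"
    and P :: "'a set set"
    and N :: "nat set"
    and p :: "nat \<Rightarrow> 'a set"
  assumes "compact X"
    and "countable P"
    and "basis_of (top_of_set X) P"
    and "{} \<notin> P"
    and "enumeration_of N p P"
  shows "omega_cap_basis (top_of_set X) P \<longleftrightarrow>
         (infinite P \<longrightarrow> (\<lambda>n. diameter (p n)) \<longlonglongrightarrow> 0)"
proof -
  have "bounded q" if "q \<in> P" for q
    using basis_ofD_openin[OF assms(3) that] assms(1)
    by (meson bounded_subset compact_imp_bounded openin_imp_subset)
  then show ?thesis
    using omega_cap_basis_iff_vanishing[OF assms(1,3,4)]
      vanishing_iff_enumeration_tendsto[OF _ assms(5)] by blast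
qed

end
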